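(* Let $\alpha=\alpha(t)$, $t\in\mathbb{R}$, and $\omega=\omega(s)$, $s\in\mathbb{R}$, be regular periodic planar curves with values in $\mathbb{C}\setminus\{0\}$, with periods $T$ and $S$ respectively, such that $$\int_0^{T}\langle\alpha',J\alpha\rangle\,dt=0=\int_0^{S}\langle\dot\omega,J\omega\rangle\,ds.$$ Then the Lagrangian immersion $\Phi=\alpha\ast\omega:\mathbb{R}^2\to\mathbb{C}^2$ is doubly periodic; concretely, $\Phi(t+T,s)=\Phi(t,s)=\Phi(t,s+S)$ for all $(t,s)\in\mathbb{R}^2$.
   Context: For base points $t_0,s_0\in\mathbb{R}$, $$(\alpha\ast\omega)(t,s)=\left(\int_{s_0}^s\dot\omega(y)\overline{\omega(y)}\,dy-\int_{t_0}^t\alpha'(x)\overline{\alpha(x)}\,dx\, ,\ \alpha(t)\omega(s)\right)\in\mathbb{C}^2,$$ where $'$ and $\dot{}$ denote derivatives in $t$ and $s$; changing base points only changes the map by a translation. It is a Lagrangian immersion. $J$ denotes rotation by $+\pi/2$ on $\mathbb{C}\equiv\mathbb{R}^2$ and $\langle\ ,\ \rangle$ the Euclidean inner product, so $\langle\alpha',J\alpha\rangle=\mathrm{Im}(\alpha'\overline{\alpha})$. *)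

theory Defs
  imports "HOL-Analysis.Analysis"
begin

definition J :: "complex \<Rightarrow> complex" where
  "J z = \<i> * z"

text \<open>Only \<open>C\<^sup>1\<close> regularity is required, so \<open>C\<^sup>\<infinity>\<close> regular curves are included.\<close>

definition regular_curve :: "(real \<Rightarrow> complex) \<Rightarrow> bool" where
  "regular_curve \<gamma> \<longleftrightarrow>
     \<gamma> C1_differentiable_on UNIV \<and> (\<forall>t. vector_derivative \<gamma> (at t) \<noteq> 0)"

text \<open>
  The base points \<open>t0\<close> and \<open>s0\<close> are explicit parameters.  The interval integral is oriented,
  i.e. it changes sign when the upper bound lies below the base point.
\<close>

definition curve_prod ::
    "real \<Rightarrow> real \<Rightarrow> (real \<Rightarrow> complex) \<Rightarrow> (real \<Rightarrow> complex) \<Rightarrow> real \<times> real \<Rightarrow> complex \<times> complex" where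
  "curve_prod t0 s0 \<alpha> \<omega> = (\<lambda>(t, s).
     ((LBINT y=s0..s. vector_derivative \<omega> (at y) * cnj (\<omega> y))
        - (LBINT x=t0..t. vector_derivative \<alpha> (at x) * cnj (\<alpha> x)),
      \<alpha> t * \<omega> s))"

text \<open>The Kaehler form is \<open>\<langle>i z, w\<rangle>\<close>, for the Euclidean inner product of \<open>\<complex>\<^sup>2\<close>.\<close>

definition kaehler_form :: "complex \<times> complex \<Rightarrow> complex \<times> complex \<Rightarrow> real" where
  "kaehler_form z w = (J (fst z), J (snd z)) \<bullet> w"

definition lagrangian_immersion :: "(real \<times> real \<Rightarrow> complex \<times> complex) \<Rightarrow> bool" where
  "lagrangian_immersion F \<longleftrightarrow>
     (\<exists>F' :: real \<times> real \<Rightarrow> (real \<times> real) \<Rightarrow>\<^sub>L (complex \<times> complex).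
        (\<forall>p. (F has_derivative blinfun_apply (F' p)) (at p)) \<and> continuous_on UNIV F' \<and>
        (\<forall>p. inj (blinfun_apply (F' p)) \<and>
             (\<forall>u v. kaehler_form (blinfun_apply (F' p) u) (blinfun_apply (F' p) v) = 0)))"

lemma has_vector_derivative_interval_integral:
  fixes f :: "real \<Rightarrow> complex" and c x :: real
  assumes "continuous_on UNIV f"
  shows "((\<lambda>u::real. LBINT y=c..u. f y) has_vector_derivative f x) (at x)"
proof -
  let ?a = "min c x - 1" and ?b = "max c x + 1"
  have "((\<lambda>u::real. LBINT y=c..u. f y) has_vector_derivative f x) (at x within {?a..?b})"
    by (rule interval_integral_FTC2)
      (use assms in \<open>auto intro: continuous_on_subset\<close>)
  moreover have "at x within {?a..?b} = at x"
    by (rule at_within_interior) auto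
  ultimately show ?thesis by simp
qed

lemma regular_curveD:
  assumes "regular_curve \<gamma>"
  shows "(\<gamma> has_vector_derivative vector_derivative \<gamma> (at t)) (at t)"
    and "continuous_on UNIV (\<lambda>t. vector_derivative \<gamma> (at t))"
    and "continuous_on UNIV \<gamma>"
    and "vector_derivative \<gamma> (at t) \<noteq> 0"
proof -
  have d: "(\<gamma> has_vector_derivative vector_derivative \<gamma> (at t)) (at t)" for t
    using assms unfolding regular_curve_def C1_differentiable_on_eq
    by (simp add: vector_derivative_works)
  then show "(\<gamma> has_vector_derivative vector_derivative \<gamma> (at t)) (at t)" .
  show "continuous_on UNIV (\<lambda>t. vector_derivative \<gamma> (at t))"
    and "vector_derivative \<gamma> (at t) \<noteq> 0"
    using assms unfolding regular_curve_def C1_differentiable_on_eq by auto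
  show "continuous_on UNIV \<gamma>"
    using d has_vector_derivative_continuous continuous_at_imp_continuous_on by blast
qed

lemma lagrangian_immersion_curve_prod:
  assumes reg: "regular_curve \<alpha>" "regular_curve \<omega>"
    and nz: "\<And>t. \<alpha> t \<noteq> 0" "\<And>s. \<omega> s \<noteq> 0"
  shows "lagrangian_immersion (curve_prod t0 s0 \<alpha> \<omega>)"
proof -
  define A where "A = (\<lambda>t. vector_derivative \<alpha> (at t))"
  define W where "W = (\<lambda>s. vector_derivative \<omega> (at s))"
  note a = regular_curveD[OF reg(1), folded A_def]
  note w = regular_curveD[OF reg(2), folded W_def]
  have cA: "continuous_on UNIV A" using a(2) unfolding A_def .
  have cW: "continuous_on UNIV W" using w(2) unfolding W_def .
  have da: "(\<alpha> has_vector_derivative A t) (at t)" for t using a(1) unfolding A_def .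
  have dw: "(\<omega> has_vector_derivative W t) (at t)" for t using w(1) unfolding W_def .
  have A0: "A t \<noteq> 0" for t using a(4) unfolding A_def .
  have W0: "W t \<noteq> 0" for t using w(4) unfolding W_def .
  define D where "D = (\<lambda>(p::real\<times>real) (u::real\<times>real).
     (snd u *\<^sub>R (W (snd p) * cnj (\<omega> (snd p))) - fst u *\<^sub>R (A (fst p) * cnj (\<alpha> (fst p))),
      \<alpha> (fst p) * snd u *\<^sub>R W (snd p) + fst u *\<^sub>R A (fst p) * \<omega> (snd p)))"
  have bl: "bounded_linear (D p)" for p
    unfolding D_def by (intro bounded_linear_intros)
  define F' where "F' = (\<lambda>p. Blinfun (D p))"
  have F': "blinfun_apply (F' p) = D p" for p
    unfolding F'_def by (rule bounded_linear_Blinfun_apply[OF bl])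
  have dH: "((\<lambda>u::real. LBINT y=s0..u. W y * cnj (\<omega> y)) has_vector_derivative W s * cnj (\<omega> s)) (at s)" for s
    by (rule has_vector_derivative_interval_integral) (intro continuous_intros cW w(3))
  have dG: "((\<lambda>u::real. LBINT x=t0..u. A x * cnj (\<alpha> x)) has_vector_derivative A t * cnj (\<alpha> t)) (at t)" for t
    by (rule has_vector_derivative_interval_integral) (intro continuous_intros cA a(3))
  have chain1: "((\<lambda>q. f (fst q)) has_derivative (\<lambda>u. fst u *\<^sub>R f')) (at p)"
    if "(f has_vector_derivative f') (at (fst p))"
    for f :: "real \<Rightarrow> complex" and f' and p :: "real\<times>real"
    using has_derivative_compose[OF has_derivative_fst[OF has_derivative_ident]
        that[unfolded has_vector_derivative_def]] .
  have chain2: "((\<lambda>q. f (snd q)) has_derivative (\<lambda>u. snd u *\<^sub>R f')) (at p)"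
    if "(f has_vector_derivative f') (at (snd p))"
    for f :: "real \<Rightarrow> complex" and f' and p :: "real\<times>real"
    using has_derivative_compose[OF has_derivative_snd[OF has_derivative_ident]
        that[unfolded has_vector_derivative_def]] .
  have F_eq: "curve_prod t0 s0 \<alpha> \<omega> = (\<lambda>q :: real \<times> real.
     ((LBINT y=s0..snd q. W y * cnj (\<omega> y)) - (LBINT x=t0..fst q. A x * cnj (\<alpha> x)),
      \<alpha> (fst q) * \<omega> (snd q)))"
    unfolding curve_prod_def A_def W_def by (rule ext) (simp add: case_prod_beta)
  have deriv: "(curve_prod t0 s0 \<alpha> \<omega> has_derivative blinfun_apply (F' p)) (at p)" for p
    unfolding F_eq F' D_def
    by (intro has_derivative_Pair has_derivative_diff has_derivative_mult
        chain2[OF dH] chain1[OF dG] chain1[OF da] chain2[OF dw])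
  have cont: "continuous_on UNIV F'"
  proof (rule continuous_on_blinfun_componentwise)
    fix i :: "real \<times> real"
    have [continuous_intros]: "continuous_on UNIV (\<lambda>p::real\<times>real. f (fst p))"
      "continuous_on UNIV (\<lambda>p::real\<times>real. f (snd p))"
      if "continuous_on UNIV f" for f :: "real \<Rightarrow> complex"
      by (auto intro!: continuous_on_compose2[OF that] continuous_intros)
    show "continuous_on UNIV (\<lambda>p. blinfun_apply (F' p) i)"
      unfolding F' D_def by (intro continuous_intros cA cW a(3) w(3))
  qed
  have inj: "inj (blinfun_apply (F' p))" for p
  proof (rule linear_injective_0[THEN iffD2, rule_format])
    show "linear (blinfun_apply (F' p))"
      by (simp add: blinfun.bounded_linear_right bounded_linear.linear)
    fix u assume "blinfun_apply (F' p) u = 0"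
    then have u: "D p u = 0" by (simp add: F')
    define x y where "x = \<alpha> (fst p)" and "y = \<omega> (snd p)"
    define X Y where "X = fst u *\<^sub>R A (fst p)" and "Y = snd u *\<^sub>R W (snd p)"
    have 1: "Y * cnj y = X * cnj x" and 2: "x * Y + X * y = 0"
      using u by (auto simp: D_def X_def Y_def x_def y_def zero_prod_def)
    have "X * (x * cnj x + y * cnj y) = x * (X * cnj x) + X * y * cnj y"
      by (simp add: algebra_simps)
    also have "\<dots> = (x * Y + X * y) * cnj y"
      by (simp add: 1[symmetric] algebra_simps)
    finally have "X * (x * cnj x + y * cnj y) = 0" using 2 by simp
    moreover have "x * cnj x + y * cnj y = of_real ((cmod x)\<^sup>2 + (cmod y)\<^sup>2)"
      by (simp only: complex_norm_square of_real_add)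
    moreover have "(cmod x)\<^sup>2 + (cmod y)\<^sup>2 \<noteq> 0"
      using nz by (simp add: x_def sum_power2_eq_zero_iff)
    ultimately have X: "X = 0" by (metis mult_eq_0_iff of_real_eq_0_iff)
    with 1 nz have Y: "Y = 0" by (simp add: y_def)
    from X Y show "u = 0"
      using A0 W0 by (simp add: X_def Y_def prod_eq_iff)
  qed
  have lag: "kaehler_form (blinfun_apply (F' p) u) (blinfun_apply (F' p) v) = 0" for p u v
    by (simp add: F' D_def kaehler_form_def J_def inner_complex_def algebra_simps)
  show ?thesis
    unfolding lagrangian_immersion_def using deriv cont inj lag by blast
qed

end

theory Submission
  imports Defs
begin

text \<open>
  Let \<open>G\<close> be an antiderivative of \<open>\<gamma>' cnj \<gamma>\<close>, where \<open>\<gamma>\<close> has period \<open>P\<close>.  The integrand has period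
  \<open>P\<close> as well, so \<open>G (t + P) - G t\<close> is constant, namely the integral over one period.  Its imaginary
  part is the integral of \<open>\<langle>\<gamma>', J \<gamma>\<rangle>\<close>, which vanishes by assumption, and its real part is the
  increment of \<open>\<bar>\<gamma>\<bar>\<^sup>2 / 2\<close>, which vanishes by periodicity.
\<close>

lemma has_vector_derivative_at_shift:
  fixes f :: "real \<Rightarrow> 'a::real_normed_vector"
  assumes "(f has_vector_derivative f') (at (t + P))"
  shows "((\<lambda>u. f (u + P)) has_vector_derivative f') (at t)"
proof -
  have "((\<lambda>u. u + P) has_vector_derivative 1) (at t)"
    by (auto intro!: derivative_eq_intros)
  from vector_diff_chain_at[OF this assms] show ?thesis by (simp add: o_def)
qed

lemma vector_derivative_periodic:
  fixes f :: "real \<Rightarrow> 'a::real_normed_vector"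
  assumes "\<And>t. (f has_vector_derivative f' t) (at t)" and "\<And>t. f (t + P) = f t"
  shows "f' (t + P) = f' t"
proof -
  have "((\<lambda>u. f (u + P)) has_vector_derivative f' (t + P)) (at t)"
    using assms(1) by (rule has_vector_derivative_at_shift)
  then have "(f has_vector_derivative f' (t + P)) (at t)"
    by (simp add: assms(2))
  then show ?thesis
    using assms(1) vector_derivative_unique_at by blast
qed

text \<open>The increment over \<open>P\<close> has derivative \<open>g (u + P) - g u\<close>, which
  vanishes by periodicity, so its value at \<open>t\<close> equals its value at 0.\<close>

lemma antiderivative_increment_periodic:
  fixes G :: "real \<Rightarrow> 'a::real_normed_vector"
  assumes G: "\<And>t. (G has_vector_derivative g t) (at t)" and "\<And>t. g (t + P) = g t"
  shows "G (t + P) - G t = G P - G 0"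
proof -
  have shift: "((\<lambda>u. G (u + P)) has_vector_derivative g (u + P)) (at u)" for u
    using G by (rule has_vector_derivative_at_shift)
  have "((\<lambda>u. G (u + P) - G u) has_vector_derivative 0) (at u)" for u
    using has_vector_derivative_diff[OF shift G, of u] assms(2) by simp
  then obtain c where "\<And>u. G (u + P) - G u = c"
    using has_vector_derivative_zero_constant[of UNIV "\<lambda>u. G (u + P) - G u"] by auto
  from this[of t] this[of 0] show ?thesis by simp
qed

text \<open>\<open>G\<close> is an arbitrary antiderivative because the integrals in
  \<open>curve_prod\<close> start at an arbitrary base point, whereas \<open>int\<close> starts at
  0.\<close>

lemma antiderivative_derivative_cnj_periodic:
  fixes \<gamma> G :: "real \<Rightarrow> complex" and P :: real
  assumes reg: "regular_curve \<gamma>"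
    and per: "\<And>t. \<gamma> (t + P) = \<gamma> t"
    and int: "(LBINT t=0..P. vector_derivative \<gamma> (at t) \<bullet> J (\<gamma> t)) = 0"
    and G: "\<And>t. (G has_vector_derivative vector_derivative \<gamma> (at t) * cnj (\<gamma> t)) (at t)"
  shows "G (t + P) = G t"
proof -
  define A where "A = (\<lambda>t. vector_derivative \<gamma> (at t))"
  have dA: "(\<gamma> has_vector_derivative A t) (at t)" for t
    unfolding A_def by (rule regular_curveD(1)[OF reg])
  have cont: "continuous_on UNIV A" "continuous_on UNIV \<gamma>"
    using regular_curveD(2,3)[OF reg] by (auto simp: A_def)
  have dG: "(G has_vector_derivative A t * cnj (\<gamma> t)) (at t)" for t
    using G by (simp add: A_def)
  have "A (t + P) = A t" for t
    using vector_derivative_periodic[OF dA per] .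
  \<comment> \<open>It remains to prove \<open>G P = G 0\<close>, separately for imaginary and real
    parts.\<close>
  then have incr: "G (t + P) - G t = G P - G 0"
    by (intro antiderivative_increment_periodic[OF dG]) (simp add: per)
  \<comment> \<open>Uses that the imaginary part of \<open>a * cnj z\<close> is the inner product of
    \<open>a\<close> with \<open>J z\<close>.\<close>
  have dIm: "((\<lambda>u. Im (G u)) has_vector_derivative A t \<bullet> J (\<gamma> t)) (at t)" for t
    using bounded_linear.has_vector_derivative[OF bounded_linear_Im dG, of t]
    by (simp add: J_def inner_complex_def algebra_simps)
  have "continuous_on UNIV (\<lambda>t. A t \<bullet> J (\<gamma> t))"
    unfolding J_def by (intro continuous_intros cont)
  then have "(LBINT t=ereal 0..ereal P. A t \<bullet> J (\<gamma> t)) = Im (G P) - Im (G 0)"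
    by (intro interval_integral_FTC_finite has_vector_derivative_at_within[OF dIm])
      (erule continuous_on_subset, rule subset_UNIV)
  with int have Im: "Im (G P) = Im (G 0)"
    by (simp add: A_def zero_ereal_def)
  \<comment> \<open>The real part of \<open>A t * cnj (\<gamma> t)\<close> is
    \<open>A t \<bullet> \<gamma> t\<close>, half the derivative of the squared modulus of
    \<open>\<gamma>\<close>.\<close>
  have "((\<lambda>u. 2 * Re (G u) - \<gamma> u \<bullet> \<gamma> u) has_vector_derivative 0) (at t)" for t
  proof -
    have "((\<lambda>u. Re (G u)) has_vector_derivative A t \<bullet> \<gamma> t) (at t)"
      using bounded_linear.has_vector_derivative[OF bounded_linear_Re dG, of t]
      by (simp add: inner_complex_def)
    moreover have "((\<lambda>u. \<gamma> u \<bullet> \<gamma> u) has_vector_derivative \<gamma> t \<bullet> A t + A t \<bullet> \<gamma> t) (at t)"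
      using bounded_bilinear.has_vector_derivative[OF bounded_bilinear_inner dA dA] .
    ultimately show ?thesis
      by (auto intro!: derivative_eq_intros simp: inner_commute)
  qed
  then obtain c where "\<And>u. 2 * Re (G u) - \<gamma> u \<bullet> \<gamma> u = c"
    using has_vector_derivative_zero_constant[of UNIV "\<lambda>u. 2 * Re (G u) - \<gamma> u \<bullet> \<gamma> u"] by auto
  \<comment> \<open>The squared moduli cancel since \<open>\<gamma> P = \<gamma> 0\<close>.\<close>
  from this[of P] this[of 0] per[of 0] have "Re (G P) = Re (G 0)" by simp
  with Im incr show ?thesis by (simp add: complex_eq_iff)
qed

lemma integral_derivative_cnj_periodic:
  fixes \<gamma> :: "real \<Rightarrow> complex" and P c t :: real
  assumes reg: "regular_curve \<gamma>"
    and "\<And>t. \<gamma> (t + P) = \<gamma> t"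
    and "(LBINT t=0..P. vector_derivative \<gamma> (at t) \<bullet> J (\<gamma> t)) = 0"
  shows "(LBINT x=c..ereal (t + P). vector_derivative \<gamma> (at x) * cnj (\<gamma> x)) =
    (LBINT x=c..t. vector_derivative \<gamma> (at x) * cnj (\<gamma> x))"
proof (rule antiderivative_derivative_cnj_periodic[OF assms])
  show "((\<lambda>u. LBINT x=c..u. vector_derivative \<gamma> (at x) * cnj (\<gamma> x)) has_vector_derivative
    vector_derivative \<gamma> (at t) * cnj (\<gamma> t)) (at t)" for t
    by (intro has_vector_derivative_interval_integral continuous_intros regular_curveD(2,3)[OF reg])
qed

theorem proposition3p1:
  fixes \<alpha> \<omega> :: "real \<Rightarrow> complex" and T S t0 s0 :: real
    and \<Phi> :: "real \<times> real \<Rightarrow> complex \<times> complex"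
  assumes "regular_curve \<alpha>" and "regular_curve \<omega>"
    and "\<And>t. \<alpha> t \<noteq> 0" and "\<And>s. \<omega> s \<noteq> 0"
    and "T > 0" and "\<And>t. \<alpha> (t + T) = \<alpha> t"
    and "S > 0" and "\<And>s. \<omega> (s + S) = \<omega> s"
    and "(LBINT t=0..T. vector_derivative \<alpha> (at t) \<bullet> J (\<alpha> t)) = 0"
    and "(LBINT s=0..S. vector_derivative \<omega> (at s) \<bullet> J (\<omega> s)) = 0"
  defines "\<Phi> \<equiv> curve_prod t0 s0 \<alpha> \<omega>"
  shows "\<forall>t s. \<Phi> (t + T, s) = \<Phi> (t, s) \<and> \<Phi> (t, s) = \<Phi> (t, s + S)"
  \<comment> \<open>Each shift changes the upper bound of only one integral in the first component
    and the argument of only one factor in the second.\<close>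
  by (simp add: \<Phi>_def curve_prod_def assms(6,8)
      integral_derivative_cnj_periodic[OF assms(1,6,9)]
      integral_derivative_cnj_periodic[OF assms(2,8,10)]
      del: plus_ereal.simps)

end
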